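(* Let $\succsim$ be a CRDU preference relation on $\mathcal X$, represented by a continuous strictly increasing $u:\mathbb R\to\mathbb R$, a continuous strictly increasing distortion function $g$, and a continuous risk-conforming capacity $\nu$, i.e. $$X\succsim Y\iff\int u(X)\,\mathrm d(g\circ\nu)\ge\int u(Y)\,\mathrm d(g\circ\nu),\qquad X,Y\in\mathcal X.$$ Then the robust aggregation $$X\succsim Y\iff\min_{\mu\in\mathfrak C(\nu)}\int_\Omega u(X)\,\mathrm d(g\circ\mu)\ \ge\ \min_{\mu\in\mathfrak C(\nu)}\int_\Omega u(Y)\,\mathrm d(g\circ\mu),\qquad X,Y\in\mathcal X,$$ holds if and only if $\nu$ is supermodular.
   Context: Setting. $(\Omega,\mathcal F)$ is a measurable space, $\mathcal G\subseteq\mathcal F$ is a sub-$\sigma$-algebra, and $\mathbb P:\mathcal G\to[0,1]$ is a (countably additive) probability measure that is atomless: $\{\mathbb P(B):B\in\mathcal G,\,B\subseteq A\}=[0,\mathbb P(A)]$ for every $A\in\mathcal G$. $\mathcal X$ is the set of acts, i.e. bounded $\mathcal F$-measurable functions $X:\Omega\to\mathbb R$. A preference relation $\succsim$ is a total preorder on $\mathcal X$. $\mathcal M_1$ is the set of countably additive probability measures on $(\Omega,\mathcal F)$. A capacity is $\nu:\mathcal F\to\mathbb R$ with $\nu(\varnothing)=0$, $\nu(\Omega)=1$, and $\nu(A)\le\nu(B)$ whenever $A\subseteq B$. It is continuous if $\nu(A_n)\to\nu(\bigcup_n A_n)$ for increasing sequences and $\nu(A_n)\to\nu(\bigcap_n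 A_n)$ for decreasing sequences. It is risk conforming if $\nu|_{\mathcal G}=\mathbb P$. It is supermodular if $\nu(A)+\nu(B)\le\nu(A\cup B)+\nu(A\cap B)$ for all $A,B\in\mathcal F$. Its core is $\mathfrak C(\nu)=\{\mu\in\mathcal M_1:\mu(A)\ge\nu(A)\text{ for all }A\in\mathcal F\}$. A distortion function is an increasing $g:[0,1]\to[0,1]$ with $g(0)=0$, $g(1)=1$. For a capacity $\kappa$ the (Choquet) integral is $\int X\,\mathrm d\kappa=\int_0^\infty\kappa(X>x)\,\mathrm dx+\int_{-\infty}^0(\kappa(X>x)-1)\,\mathrm dx$; integrals with respect to $g\circ\nu$ and $g\circ\mu$ are Choquet integrals. Writing $\min$ includes the assertion that the minimum exists (in particular that the core is nonempty). *)

theory Defs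
  imports "HOL-Probability.Probability"
begin

text \<open>
  A measurable space is a value \<open>M :: 'a measure\<close> of which only \<open>space M\<close> and
  \<open>sets M\<close> are used. Set functions have type \<open>'a set \<Rightarrow> real\<close> and are only
  ever evaluated on \<open>sets M\<close>.
\<close>

definition atomless :: "'a measure \<Rightarrow> bool" where
  "atomless P \<longleftrightarrow> (\<forall>A\<in>sets P. {measure P B | B. B \<in> sets P \<and> B \<subseteq> A} = {0..measure P A})"

text \<open>
  Acts that agree on \<open>space M\<close> are not identified. This is harmless: integrals do not
  depend on values outside \<open>space M\<close>, so a preference represented by integrals does not
  either.
\<close>

definition acts :: "'a measure \<Rightarrow> ('a \<Rightarrow> real) set" where
  "acts M = {X \<in> borel_measurable M. bounded (X ` space M)}"

definition preference_relation :: "'a measure \<Rightarrow> ('a \<Rightarrow> real) rel \<Rightarrow> bool" where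
  "preference_relation M R \<longleftrightarrow> preorder_on (acts M) R \<and> total_on (acts M) R"

definition capacity :: "'a measure \<Rightarrow> ('a set \<Rightarrow> real) \<Rightarrow> bool" where
  "capacity M \<nu> \<longleftrightarrow> \<nu> {} = 0 \<and> \<nu> (space M) = 1 \<and>
     (\<forall>A\<in>sets M. \<forall>B\<in>sets M. A \<subseteq> B \<longrightarrow> \<nu> A \<le> \<nu> B)"

definition continuous_capacity :: "'a measure \<Rightarrow> ('a set \<Rightarrow> real) \<Rightarrow> bool" where
  "continuous_capacity M \<nu> \<longleftrightarrow> capacity M \<nu> \<and>
     (\<forall>A :: nat \<Rightarrow> 'a set. range A \<subseteq> sets M \<longrightarrow>
        (incseq A \<longrightarrow> (\<lambda>n. \<nu> (A n)) \<longlonglongrightarrow> \<nu> (\<Union>n. A n)) \<and>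
        (decseq A \<longrightarrow> (\<lambda>n. \<nu> (A n)) \<longlonglongrightarrow> \<nu> (\<Inter>n. A n)))"

definition risk_conforming :: "'a measure \<Rightarrow> ('a set \<Rightarrow> real) \<Rightarrow> bool" where
  "risk_conforming P \<nu> \<longleftrightarrow> (\<forall>A\<in>sets P. \<nu> A = measure P A)"

definition supermodular :: "'a measure \<Rightarrow> ('a set \<Rightarrow> real) \<Rightarrow> bool" where
  "supermodular M \<nu> \<longleftrightarrow>
     (\<forall>A\<in>sets M. \<forall>B\<in>sets M. \<nu> A + \<nu> B \<le> \<nu> (A \<union> B) + \<nu> (A \<inter> B))"

definition core :: "'a measure \<Rightarrow> ('a set \<Rightarrow> real) \<Rightarrow> 'a measure set" where
  "core M \<nu> = {\<mu>. prob_space \<mu> \<and> sets \<mu> = sets M \<and> (\<forall>A\<in>sets M. measure \<mu> A \<ge> \<nu> A)}"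

definition distortion :: "(real \<Rightarrow> real) \<Rightarrow> bool" where
  "distortion g \<longleftrightarrow> g ` {0..1} \<subseteq> {0..1} \<and> mono_on {0..1} g \<and> g 0 = 0 \<and> g 1 = 1"

definition choquet :: "'a measure \<Rightarrow> ('a set \<Rightarrow> real) \<Rightarrow> ('a \<Rightarrow> real) \<Rightarrow> real" where
  "choquet M \<kappa> X =
     (LINT x:{0..}|lborel. \<kappa> {\<omega> \<in> space M. X \<omega> > x}) +
     (LINT x:{..0}|lborel. \<kappa> {\<omega> \<in> space M. X \<omega> > x} - 1)"

definition CRDU :: "'a measure \<Rightarrow> 'a measure \<Rightarrow> (real \<Rightarrow> real) \<Rightarrow> (real \<Rightarrow> real) \<Rightarrow>
    ('a set \<Rightarrow> real) \<Rightarrow> ('a \<Rightarrow> real) rel \<Rightarrow> bool" where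
  "CRDU M P u g \<nu> R \<longleftrightarrow>
     preference_relation M R \<and>
     continuous_on UNIV u \<and> strict_mono u \<and>
     distortion g \<and> continuous_on {0..1} g \<and> strict_mono_on {0..1} g \<and>
     continuous_capacity M \<nu> \<and> risk_conforming P \<nu> \<and>
     (\<forall>X\<in>acts M. \<forall>Y\<in>acts M.
        (X, Y) \<in> R \<longleftrightarrow> choquet M (g \<circ> \<nu>) (u \<circ> X) \<ge> choquet M (g \<circ> \<nu>) (u \<circ> Y))"

definition has_minimum :: "real set \<Rightarrow> bool" where
  "has_minimum S \<longleftrightarrow> (\<exists>m\<in>S. \<forall>s\<in>S. m \<le> s)"

definition core_values :: "'a measure \<Rightarrow> (real \<Rightarrow> real) \<Rightarrow> (real \<Rightarrow> real) \<Rightarrow>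
    ('a set \<Rightarrow> real) \<Rightarrow> ('a \<Rightarrow> real) \<Rightarrow> real set" where
  "core_values M u g \<nu> X = (\<lambda>\<mu>. choquet M (g \<circ> measure \<mu>) (u \<circ> X)) ` core M \<nu>"

text \<open>
  \<open>LEAST\<close> is the minimum only if the minimum exists, hence the separate first conjunct.
\<close>

definition robust_aggregation :: "'a measure \<Rightarrow> (real \<Rightarrow> real) \<Rightarrow> (real \<Rightarrow> real) \<Rightarrow>
    ('a set \<Rightarrow> real) \<Rightarrow> ('a \<Rightarrow> real) rel \<Rightarrow> bool" where
  "robust_aggregation M u g \<nu> R \<longleftrightarrow>
     (\<forall>X\<in>acts M. has_minimum (core_values M u g \<nu> X)) \<and>
     (\<forall>X\<in>acts M. \<forall>Y\<in>acts M.
        (X, Y) \<in> R \<longleftrightarrow>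
        (LEAST v. v \<in> core_values M u g \<nu> X) \<ge> (LEAST v. v \<in> core_values M u g \<nu> Y))"

end

(*
  Maximality replaces Hahn-Banach in the construction of core elements. For a supermodular \<kappa> and a
  set A, the set function B \<mapsto> \<kappa> (A \<inter> B) + \<kappa> (A \<union> B) - \<kappa> A is again supermodular and dominates \<kappa>, so a
  maximal supermodular majorant of \<nu> that agrees with \<nu> on a given chain is additive; continuity of
  \<nu> at the whole space makes it countably additive. Applied to the chain of upper level sets of u(X),
  this gives a core element attaining the Choquet integral of u(X) with respect to g \<circ> \<nu>.
  Conversely, certainty equivalents force the robust minimum to equal the integral with respect to
  g \<circ> \<nu>. A minimiser \<mu> for an act with upper level sets A \<inter> B and A \<union> B then agrees with \<nu> on both
  sets, because g is strictly increasing, and additivity of \<mu> \<ge> \<nu> yields supermodularity.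
*)

theory Submission
  imports Defs
begin

section \<open>Capacities\<close>

lemma capacity_mono:
  "capacity M \<kappa> \<Longrightarrow> A \<in> sets M \<Longrightarrow> B \<in> sets M \<Longrightarrow> A \<subseteq> B \<Longrightarrow> \<kappa> A \<le> \<kappa> B"
  by (auto simp: capacity_def)

lemma capacity_bounds:
  assumes "capacity M \<kappa>" "A \<in> sets M"
  shows "0 \<le> \<kappa> A" "\<kappa> A \<le> 1"
  using capacity_mono[OF assms(1), of "{}" A] capacity_mono[OF assms(1), of A "space M"] assms
    sets.sets_into_space[of A M]
  by (auto simp: capacity_def)

text \<open>Together with \<open>core_capacity\<close> this makes every Choquet fact below, stated
  for capacities, available for \<open>g \<circ> \<nu>\<close> and for
  \<open>g \<circ> measure \<mu>\<close> with \<open>\<mu>\<close> in the core.\<close>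

lemma capacity_distortion:
  assumes "capacity M \<kappa>" "distortion g"
  shows "capacity M (g \<circ> \<kappa>)"
  using assms capacity_bounds[OF assms(1)]
  by (auto simp: capacity_def distortion_def mono_on_def)

lemma core_capacity:
  assumes "\<mu> \<in> core M \<nu>"
  shows "capacity M (measure \<mu>)"
proof -
  interpret prob_space \<mu> using assms by (simp add: core_def)
  have sets: "sets \<mu> = sets M" using assms by (simp add: core_def)
  then have "space \<mu> = space M" by (rule sets_eq_imp_space_eq)
  with sets prob_space show ?thesis
    by (auto simp: capacity_def intro: finite_measure_mono)
qed

lemma core_ge: "\<mu> \<in> core M \<nu> \<Longrightarrow> A \<in> sets M \<Longrightarrow> \<nu> A \<le> measure \<mu> A"
  by (simp add: core_def)

section \<open>Choquet integrals of acts\<close>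

lemma level_set_sets: "f \<in> acts M \<Longrightarrow> {\<omega> \<in> space M. f \<omega> > x} \<in> sets M"
  unfolding acts_def by auto

lemma act_bound:
  assumes "f \<in> acts M"
  obtains K where "0 \<le> K" "\<And>\<omega>. \<omega> \<in> space M \<Longrightarrow> \<bar>f \<omega>\<bar> \<le> K"
proof -
  from assms obtain K where "\<forall>x\<in>f ` space M. norm x \<le> K"
    by (auto simp: acts_def bounded_iff)
  then show ?thesis by (intro that[of "max 0 K"]) fastforce+
qed

lemma act_bound2:
  assumes "f \<in> acts M" "h \<in> acts M"
  obtains K where "0 \<le> K" "\<And>\<omega>. \<omega> \<in> space M \<Longrightarrow> \<bar>f \<omega>\<bar> \<le> K" "\<And>\<omega>. \<omega> \<in> space M \<Longrightarrow> \<bar>h \<omega>\<bar> \<le> K"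
proof -
  obtain K where "0 \<le> K" "\<And>\<omega>. \<omega> \<in> space M \<Longrightarrow> \<bar>f \<omega>\<bar> \<le> K" using act_bound[OF assms(1)] by blast
  moreover obtain L where "0 \<le> L" "\<And>\<omega>. \<omega> \<in> space M \<Longrightarrow> \<bar>h \<omega>\<bar> \<le> L" using act_bound[OF assms(2)] by blast
  ultimately show ?thesis by (intro that[of "max K L"]) fastforce+
qed

lemma const_acts [simp]: "(\<lambda>_. c) \<in> acts M"
  by (auto simp: acts_def bounded_iff)

lemma step_acts:
  assumes "D \<in> sets M" "E \<in> sets M"
  shows "(\<lambda>\<omega>. if \<omega> \<in> D then c else if \<omega> \<in> E then b else a) \<in> acts M"
proof -
  have "(\<lambda>\<omega>. if \<omega> \<in> D then c else if \<omega> \<in> E then b else a) ` space M \<subseteq> {a, b, c}" by auto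
  then have "bounded ((\<lambda>\<omega>. if \<omega> \<in> D then c else if \<omega> \<in> E then b else a) ` space M)"
    by (rule bounded_subset[rotated]) (simp add: finite_imp_bounded)
  with assms show ?thesis by (auto simp: acts_def intro!: measurable_If_set)
qed

lemma comp_acts:
  assumes "continuous_on UNIV u" "strict_mono u" "X \<in> acts M"
  shows "u \<circ> X \<in> acts M"
proof -
  obtain K where K: "0 \<le> K" "\<And>\<omega>. \<omega> \<in> space M \<Longrightarrow> \<bar>X \<omega>\<bar> \<le> K" using act_bound[OF assms(3)] by blast
  have "u (-K) \<le> u (X \<omega>) \<and> u (X \<omega>) \<le> u K" if "\<omega> \<in> space M" for \<omega>
    using K(2)[OF that] strict_mono_less_eq[OF assms(2)] by auto
  then have "bounded ((u \<circ> X) ` space M)"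
    by (intro bounded_subset[OF bounded_closed_interval[of "u (-K)" "u K"]]) auto
  moreover have "u \<circ> X \<in> borel_measurable M"
    using assms borel_measurable_continuous_onI[OF assms(1)] by (auto simp: acts_def)
  ultimately show ?thesis by (simp add: acts_def)
qed

text \<open>Upper level sets shrink as \<open>x\<close> grows, so the integrand is antitone, hence
  Borel; it takes values in [0,1], and the interval has finite length.\<close>

lemma level_integrable:
  assumes "capacity M \<kappa>" "f \<in> acts M"
  shows "set_integrable lborel {a..b} (\<lambda>x. \<kappa> {\<omega> \<in> space M. f \<omega> > x})"
proof -
  let ?F = "\<lambda>x. \<kappa> {\<omega> \<in> space M. f \<omega> > x}"
  have "mono (\<lambda>x. - ?F x)"
    unfolding mono_def
    by (auto intro!: capacity_mono[OF assms(1)] level_set_sets[OF assms(2)])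
  then have "(\<lambda>x. - (- ?F x)) \<in> borel_measurable borel"
    by (intro borel_measurable_uminus borel_measurable_mono)
  then show ?thesis
    unfolding set_integrable_def
    using capacity_bounds[OF assms(1) level_set_sets[OF assms(2)]]
    by (intro integrableI_bounded_set_indicator[where B=1]) (auto simp: emeasure_lborel_Icc_eq)
qed

text \<open>Above \<open>K\<close> the level sets are empty and below \<open>-K\<close> they are the
  whole space, so both half-line integrands vanish there. The summand -1 on \<open>{-K..0}\<close>
  contributes \<open>-K\<close>. Choquet integrals thereby become ordinary integrals over one
  compact interval.\<close>

lemma choquet_eq_integral:
  assumes "capacity M \<kappa>" "f \<in> acts M" and K: "0 \<le> K" "\<And>\<omega>. \<omega> \<in> space M \<Longrightarrow> \<bar>f \<omega>\<bar> \<le> K"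
  shows "choquet M \<kappa> f = (LINT x:{-K..K}|lborel. \<kappa> {\<omega> \<in> space M. f \<omega> > x}) - K"
proof -
  let ?F = "\<lambda>x. \<kappa> {\<omega> \<in> space M. f \<omega> > x}"
  have "?F x = 0" if "x > K" for x
  proof -
    have "{\<omega> \<in> space M. f \<omega> > x} = {}" using K that by force
    then show ?thesis using assms(1) unfolding capacity_def by metis
  qed
  then have "(LINT x:{0..}|lborel. ?F x) = (LINT x:{0..K}|lborel. ?F x)"
    unfolding set_lebesgue_integral_def
    by (intro Bochner_Integration.integral_cong) (auto simp: indicator_def)
  moreover have "?F x = 1" if "x < -K" for x
  proof -
    have "{\<omega> \<in> space M. f \<omega> > x} = space M" using K that by force
    then show ?thesis using assms(1) unfolding capacity_def by metis
  qed
  then have "(LINT x:{..0}|lborel. ?F x - 1) = (LINT x:{-K..0}|lborel. ?F x - 1)"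
    unfolding set_lebesgue_integral_def
    by (intro Bochner_Integration.integral_cong) (auto simp: indicator_def)
  moreover have "(LINT x:{-K..0}|lborel. ?F x - 1) = (LINT x:{-K..0}|lborel. ?F x) - K"
  proof -
    have "(LINT x:{-K..0}|lborel. ?F x - 1) = (LINT x:{-K..0}|lborel. ?F x) - (LINT x:{-K..0}|lborel. 1)"
      by (intro set_integral_diff(2) level_integrable[OF assms(1,2)])
         (simp add: set_integrable_def emeasure_lborel_Icc_eq)
    also have "(LINT x:{-K..0}|lborel. 1::real) = K"
      using K by (simp add: set_lebesgue_integral_def)
    finally show ?thesis .
  qed
  moreover have "(LINT x:{-K..K}|lborel. ?F x) = (LINT x:{-K..0}|lborel. ?F x) + (LINT x:{0..K}|lborel. ?F x)"
  proof -
    \<comment> \<open>The two intervals overlap only in the null set {0}.\<close>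
    have "AE x in lborel. x \<noteq> (0::real)" by (rule AE_lborel_singleton)
    then have "AE x in lborel. \<not> (x \<in> {-K..0} \<and> x \<in> {0..K})" by eventually_elim auto
    then have "(LINT x:{-K..0} \<union> {0..K}|lborel. ?F x) = (LINT x:{-K..0}|lborel. ?F x) + (LINT x:{0..K}|lborel. ?F x)"
      by (intro set_integral_Un_AE level_integrable assms) auto
    moreover have "{-K..0} \<union> {0..K} = {-K..K}" using K by auto
    ultimately show ?thesis by simp
  qed
  ultimately show ?thesis by (simp add: choquet_def)
qed

text \<open>The capacity and the act vary together, so this covers both two acts under one capacity
  and two capacities on one act.\<close>

lemma choquet_mono:
  assumes "capacity M \<kappa>" "capacity M \<kappa>'" "f \<in> acts M" "h \<in> acts M"
    and le: "\<And>x. \<kappa> {\<omega> \<in> space M. f \<omega> > x} \<le> \<kappa>' {\<omega> \<in> space M. h \<omega> > x}"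
  shows "choquet M \<kappa> f \<le> choquet M \<kappa>' h"
proof -
  obtain K where K: "0 \<le> K" "\<And>\<omega>. \<omega> \<in> space M \<Longrightarrow> \<bar>f \<omega>\<bar> \<le> K" "\<And>\<omega>. \<omega> \<in> space M \<Longrightarrow> \<bar>h \<omega>\<bar> \<le> K"
    using act_bound2[OF assms(3,4)] by blast
  have "(LINT x:{-K..K}|lborel. \<kappa> {\<omega> \<in> space M. f \<omega> > x}) \<le> (LINT x:{-K..K}|lborel. \<kappa>' {\<omega> \<in> space M. h \<omega> > x})"
    by (intro set_integral_mono level_integrable assms)
  then show ?thesis
    using K by (simp add: choquet_eq_integral[OF assms(1,3)] choquet_eq_integral[OF assms(2,4)])
qed

text \<open>The nonempty upper level sets of such an act are among \<open>space M\<close>,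
  \<open>E\<close> and \<open>D\<close>. It yields constants as a degenerate case and later
  evaluates the act built from \<open>A \<inter> B\<close> and \<open>A \<union> B\<close>.\<close>

lemma choquet_step:
  assumes "capacity M \<kappa>" "D \<in> sets M" "E \<in> sets M" "D \<subseteq> E" "a \<le> b" "b \<le> c"
  shows "choquet M \<kappa> (\<lambda>\<omega>. if \<omega> \<in> D then c else if \<omega> \<in> E then b else a)
    = a + (b - a) * \<kappa> E + (c - b) * \<kappa> D"
proof -
  let ?f = "\<lambda>\<omega>. if \<omega> \<in> D then c else if \<omega> \<in> E then b else a"
  define K where "K = max \<bar>a\<bar> \<bar>c\<bar>"
  have K: "0 \<le> K" "\<bar>a\<bar> \<le> K" "\<bar>b\<bar> \<le> K" "\<bar>c\<bar> \<le> K" using assms by (auto simp: K_def)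
  have f: "?f \<in> acts M"
    using assms(2,3) by (rule step_acts)
  have DE: "D \<subseteq> space M" "E \<subseteq> space M" using assms sets.sets_into_space by auto
  have "{\<omega> \<in> space M. ?f \<omega> > x} =
      (if x < a then space M else if x < b then E else if x < c then D else {})" for x
    using assms DE by (auto split: if_splits)
  \<comment> \<open>The decreasing step function of \<open>x\<close> is split at its jumps
    \<open>a\<close>, \<open>b\<close>, \<open>c\<close> into rays weighted by the jump heights; on
    \<open>{-K..K}\<close> the ray below \<open>d\<close> has length \<open>d + K\<close>.\<close>
  then have F: "\<kappa> {\<omega> \<in> space M. ?f \<omega> > x} = (1 - \<kappa> E) * indicator {..<a} x +
      (\<kappa> E - \<kappa> D) * indicator {..<b} x + \<kappa> D * indicator {..<c} x" for x
    using assms by (auto simp: capacity_def indicator_def)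
  have ind: "set_integrable lborel {-K..K} (indicator {..<d} :: real \<Rightarrow> real)"
       "(LINT x:{-K..K}|lborel. indicator {..<d} x) = d + K" if "\<bar>d\<bar> \<le> K" for d
  proof -
    have eq: "(\<lambda>x. indicator {-K..K} x *\<^sub>R indicator {..<d} x) = (indicator {-K..<d} :: real \<Rightarrow> real)"
      using that by (auto simp: indicator_def fun_eq_iff)
    show "set_integrable lborel {-K..K} (indicator {..<d} :: real \<Rightarrow> real)"
      unfolding set_integrable_def eq using that by simp
    show "(LINT x:{-K..K}|lborel. indicator {..<d} x) = d + K"
      unfolding set_lebesgue_integral_def eq using that by simp
  qed
  have "(LINT x:{-K..K}|lborel. \<kappa> {\<omega> \<in> space M. ?f \<omega> > x}) =
      (1 - \<kappa> E) * (a + K) + (\<kappa> E - \<kappa> D) * (b + K) + \<kappa> D * (c + K)"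
    unfolding F using K
    by (simp add: set_integral_add set_integral_mult_right ind)
  moreover have "choquet M \<kappa> ?f = (LINT x:{-K..K}|lborel. \<kappa> {\<omega> \<in> space M. ?f \<omega> > x}) - K"
    by (rule choquet_eq_integral[OF assms(1) f K(1)]) (use K in auto)
  ultimately show ?thesis by (simp add: algebra_simps)
qed

lemma choquet_const:
  assumes "capacity M \<kappa>"
  shows "choquet M \<kappa> (\<lambda>_. c) = c"
  using choquet_step[OF assms, of "{}" "{}" c c c] by simp

lemma choquet_mono_fun:
  assumes "capacity M \<kappa>" "f \<in> acts M" "h \<in> acts M" "\<And>\<omega>. \<omega> \<in> space M \<Longrightarrow> f \<omega> \<le> h \<omega>"
  shows "choquet M \<kappa> f \<le> choquet M \<kappa> h"
  using assms
  by (intro choquet_mono capacity_mono[OF assms(1)] level_set_sets) force+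

text \<open>Monotonicity places the integral between \<open>u (-K)\<close> and \<open>u K\<close>;
  the intermediate value theorem then gives \<open>c\<close>.\<close>

lemma certainty_equivalent:
  assumes "capacity M \<kappa>" "continuous_on UNIV u" "strict_mono u" "X \<in> acts M"
  obtains c where "choquet M \<kappa> (u \<circ> X) = u c"
proof -
  obtain K where K: "0 \<le> K" "\<And>\<omega>. \<omega> \<in> space M \<Longrightarrow> \<bar>X \<omega>\<bar> \<le> K" using act_bound[OF assms(4)] by blast
  have uX: "u (-K) \<le> u (X \<omega>) \<and> u (X \<omega>) \<le> u K" if "\<omega> \<in> space M" for \<omega>
    using K(2)[OF that] strict_mono_less_eq[OF assms(3)] by auto
  have "choquet M \<kappa> (\<lambda>_. u (-K)) \<le> choquet M \<kappa> (u \<circ> X)" "choquet M \<kappa> (u \<circ> X) \<le> choquet M \<kappa> (\<lambda>_. u K)"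
    using uX by (auto intro!: choquet_mono_fun comp_acts assms)
  then have "u (-K) \<le> choquet M \<kappa> (u \<circ> X)" "choquet M \<kappa> (u \<circ> X) \<le> u K"
    by (simp_all add: choquet_const assms)
  then have "\<exists>c\<ge>-K. c \<le> K \<and> u c = choquet M \<kappa> (u \<circ> X)"
    using K(1) by (intro IVT') (auto intro: continuous_on_subset[OF assms(2)])
  then show ?thesis using that by metis
qed

section \<open>Core elements matching a supermodular capacity on a chain\<close>

text \<open>Only values on \<open>sets M\<close> matter. Fixing the others at 0 keeps them from
  being raised forever, so that maximal elements of the pointwise order on functions can
  exist.\<close>

definition supermodular_majorants ::
    "'a measure \<Rightarrow> ('a set \<Rightarrow> real) \<Rightarrow> 'a set set \<Rightarrow> ('a set \<Rightarrow> real) set" where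
  "supermodular_majorants M \<nu> C = {\<kappa>. (\<forall>A. A \<notin> sets M \<longrightarrow> \<kappa> A = 0) \<and> capacity M \<kappa> \<and>
     supermodular M \<kappa> \<and> (\<forall>A\<in>sets M. \<nu> A \<le> \<kappa> A) \<and> (\<forall>A\<in>C. \<kappa> A = \<nu> A)}"

text \<open>The sum of the restriction of \<open>\<kappa>\<close> to \<open>A\<close> and the
  contraction of \<open>\<kappa>\<close> by \<open>A\<close>. On measurable sets it equals
  \<open>\<kappa>\<close> exactly when \<open>\<kappa>\<close> satisfies the modular equation for
  \<open>A\<close> against every \<open>B\<close>.\<close>

definition modularize :: "'a measure \<Rightarrow> ('a set \<Rightarrow> real) \<Rightarrow> 'a set \<Rightarrow> 'a set \<Rightarrow> real" where
  "modularize M \<kappa> A B = (if B \<in> sets M then \<kappa> (A \<inter> B) + \<kappa> (A \<union> B) - \<kappa> A else 0)"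

text \<open>Intersection and union with \<open>A\<close> are lattice homomorphisms by
  distributivity, so supermodularity of \<open>\<kappa>\<close> transfers to both summands.
  Domination of \<open>\<kappa>\<close> is its supermodularity at \<open>A\<close> and
  \<open>B\<close>, and \<open>eq\<close> keeps the values on \<open>C\<close> fixed.\<close>

lemma modularize_majorant:
  assumes \<kappa>: "\<kappa> \<in> supermodular_majorants M \<nu> C" and C: "C \<subseteq> sets M" and A: "A \<in> sets M"
    and eq: "\<And>B. B \<in> C \<Longrightarrow> \<kappa> (A \<inter> B) + \<kappa> (A \<union> B) = \<kappa> A + \<kappa> B"
  shows "modularize M \<kappa> A \<in> supermodular_majorants M \<nu> C"
    and "\<And>B. \<kappa> B \<le> modularize M \<kappa> A B"
proof -
  note d = \<kappa>[unfolded supermodular_majorants_def, simplified]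
  from d have cap: "capacity M \<kappa>" and sup: "supermodular M \<kappa>" by auto
  show ge: "\<kappa> B \<le> modularize M \<kappa> A B" for B
    using d A by (auto simp: modularize_def supermodular_def algebra_simps)
  have "A \<subseteq> space M" using A sets.sets_into_space by auto
  then have "A \<inter> space M = A" "A \<union> space M = space M" by auto
  moreover have "\<kappa> (A \<inter> B) + \<kappa> (A \<union> B) \<le> \<kappa> (A \<inter> D) + \<kappa> (A \<union> D)"
    if "B \<in> sets M" "D \<in> sets M" "B \<subseteq> D" for B D
    using that A by (intro add_mono capacity_mono[OF cap]) auto
  ultimately have "capacity M (modularize M \<kappa> A)"
    using cap by (auto simp: capacity_def modularize_def)
  moreover have "supermodular M (modularize M \<kappa> A)"
    unfolding supermodular_def
  proof (intro ballI)
    fix B D assume BD: "B \<in> sets M" "D \<in> sets M"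
    have "\<kappa> (A \<inter> B) + \<kappa> (A \<inter> D) \<le> \<kappa> ((A \<inter> B) \<union> (A \<inter> D)) + \<kappa> ((A \<inter> B) \<inter> (A \<inter> D))"
      "\<kappa> (A \<union> B) + \<kappa> (A \<union> D) \<le> \<kappa> ((A \<union> B) \<union> (A \<union> D)) + \<kappa> ((A \<union> B) \<inter> (A \<union> D))"
      using sup A BD by (auto simp: supermodular_def)
    moreover have "(A \<inter> B) \<union> (A \<inter> D) = A \<inter> (B \<union> D)" "(A \<inter> B) \<inter> (A \<inter> D) = A \<inter> (B \<inter> D)"
      "(A \<union> B) \<union> (A \<union> D) = A \<union> (B \<union> D)" "(A \<union> B) \<inter> (A \<union> D) = A \<union> (B \<inter> D)" by auto
    ultimately show "modularize M \<kappa> A B + modularize M \<kappa> A D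
        \<le> modularize M \<kappa> A (B \<union> D) + modularize M \<kappa> A (B \<inter> D)"
      using BD by (simp add: modularize_def)
  qed
  moreover have "modularize M \<kappa> A B = \<nu> B" if "B \<in> C" for B
    using eq[OF that] d C that by (auto simp: modularize_def)
  moreover have "\<nu> B \<le> modularize M \<kappa> A B" if "B \<in> sets M" for B
    using d ge[of B] that by force
  ultimately show "modularize M \<kappa> A \<in> supermodular_majorants M \<nu> C"
    by (auto simp: supermodular_majorants_def modularize_def)
qed

text \<open>The bound is the pointwise supremum, finite because capacities are at most 1. Only
  supermodularity needs the chain property, since its left side adds two suprema.\<close>

lemma supermodular_majorants_chain_bound:
  assumes ne: "Q \<noteq> {}" and Q: "Q \<subseteq> supermodular_majorants M \<nu> C" and C: "C \<subseteq> sets M"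
    and ch: "\<And>\<kappa> \<kappa>'. \<kappa> \<in> Q \<Longrightarrow> \<kappa>' \<in> Q \<Longrightarrow> \<kappa> \<le> \<kappa>' \<or> \<kappa>' \<le> \<kappa>"
  shows "\<exists>s\<in>supermodular_majorants M \<nu> C. \<forall>\<kappa>\<in>Q. \<kappa> \<le> s"
proof -
  define s where "s A = (SUP \<kappa>\<in>Q. \<kappa> A)" for A
  note maj = subsetD[OF Q, unfolded supermodular_majorants_def, simplified]
  have le1: "\<kappa> A \<le> 1" if "\<kappa> \<in> Q" for \<kappa> A
    using maj[OF that] capacity_bounds(2)[of M \<kappa> A] by (cases "A \<in> sets M") auto
  then have ub: "\<kappa> A \<le> s A" if "\<kappa> \<in> Q" for \<kappa> A
    unfolding s_def using that by (intro cSUP_upper bdd_aboveI2[where M=1])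
  have lub: "s A \<le> y" if "\<And>\<kappa>. \<kappa> \<in> Q \<Longrightarrow> \<kappa> A \<le> y" for A y
    unfolding s_def using that ne by (intro cSUP_least)
  have const: "s A = y" if "\<And>\<kappa>. \<kappa> \<in> Q \<Longrightarrow> \<kappa> A = y" for A y
  proof -
    have "(\<lambda>\<kappa>. \<kappa> A) ` Q = {y}" using that ne by auto
    then show ?thesis by (simp add: s_def)
  qed
  have "capacity M s"
    unfolding capacity_def
  proof (intro conjI ballI impI)
    show "s {} = 0" "s (space M) = 1" using maj by (auto intro!: const simp: capacity_def)
    fix A B assume "A \<in> sets M" "B \<in> sets M" "A \<subseteq> B"
    then show "s A \<le> s B"
      using maj by (intro lub order.trans[OF capacity_mono ub]) auto
  qed
  moreover have "supermodular M s"
    unfolding supermodular_def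
  proof (intro ballI)
    fix A B assume AB: "A \<in> sets M" "B \<in> sets M"
    \<comment> \<open>Two independent members are allowed, as the larger one serves for both. The
      suprema can then be taken one at a time, first over \<open>\<kappa>\<close> and then over
      \<open>\<kappa>'\<close>.\<close>
    have *: "\<kappa> A + \<kappa>' B \<le> s (A \<union> B) + s (A \<inter> B)" if k: "\<kappa> \<in> Q" "\<kappa>' \<in> Q" for \<kappa> \<kappa>'
    proof -
      obtain \<eta> where l: "\<eta> \<in> Q" "\<kappa> \<le> \<eta>" "\<kappa>' \<le> \<eta>" using ch[OF k] k by auto
      have "\<kappa> A + \<kappa>' B \<le> \<eta> A + \<eta> B" using l by (auto simp: le_fun_def intro: add_mono)
      also have "\<dots> \<le> \<eta> (A \<union> B) + \<eta> (A \<inter> B)"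
        using maj[OF l(1)] AB by (auto simp: supermodular_def)
      also have "\<dots> \<le> s (A \<union> B) + s (A \<inter> B)" using ub[OF l(1)] by (intro add_mono)
      finally show ?thesis .
    qed
    have "s A \<le> s (A \<union> B) + s (A \<inter> B) - \<kappa>' B" if "\<kappa>' \<in> Q" for \<kappa>'
      using *[OF _ that] by (intro lub) (simp add: algebra_simps)
    then have "s B \<le> s (A \<union> B) + s (A \<inter> B) - s A"
      by (intro lub) (simp add: algebra_simps)
    then show "s A + s B \<le> s (A \<union> B) + s (A \<inter> B)" by simp
  qed
  moreover have "\<nu> A \<le> s A" if "A \<in> sets M" for A
    using ne maj that ub by (meson ex_in_conv order.trans)
  moreover have "s A = 0" if "A \<notin> sets M" for A
    using maj that by (intro const) auto
  moreover have "s A = \<nu> A" if "A \<in> C" for A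
    using maj that by (intro const) auto
  ultimately have "s \<in> supermodular_majorants M \<nu> C"
    by (simp add: supermodular_majorants_def)
  then show ?thesis using ub by (auto simp: le_fun_def)
qed

text \<open>A maximal majorant equals its modularization, first at the members of the chain and
  therefore at every set.\<close>

lemma additive_majorant_exists:
  assumes cap: "capacity M \<nu>" and sup: "supermodular M \<nu>" and C: "C \<subseteq> sets M" "chain_subset C"
  obtains \<kappa> where "capacity M \<kappa>" "\<And>A. A \<in> sets M \<Longrightarrow> \<nu> A \<le> \<kappa> A" "\<And>A. A \<in> C \<Longrightarrow> \<kappa> A = \<nu> A"
    "\<And>A B. A \<in> sets M \<Longrightarrow> B \<in> sets M \<Longrightarrow> \<kappa> (A \<inter> B) + \<kappa> (A \<union> B) = \<kappa> A + \<kappa> B"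
proof -
  let ?S = "supermodular_majorants M \<nu> C"
  have base: "(\<lambda>A. if A \<in> sets M then \<nu> A else 0) \<in> ?S"
    using cap sup C by (auto simp: supermodular_majorants_def capacity_def supermodular_def)
  have "\<exists>m\<in>?S. \<forall>\<kappa>\<in>?S. m \<le> \<kappa> \<longrightarrow> \<kappa> = m"
  proof (rule predicate_Zorn)
    show "partial_order_on ?S (relation_of (\<le>) ?S)"
      by (rule partial_order_on_relation_ofI) auto
    fix Q assume "Q \<in> Chains (relation_of (\<le>) ?S)"
    then have Q: "Q \<subseteq> ?S" "\<And>\<kappa> \<kappa>'. \<kappa> \<in> Q \<Longrightarrow> \<kappa>' \<in> Q \<Longrightarrow> \<kappa> \<le> \<kappa>' \<or> \<kappa>' \<le> \<kappa>"
      by (auto simp: Chains_def relation_of_def)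
    show "\<exists>s\<in>?S. \<forall>\<kappa>\<in>Q. \<kappa> \<le> s"
      \<comment> \<open>The empty chain is bounded by \<open>\<nu>\<close> itself, set to 0 off
        \<open>sets M\<close>.\<close>
      using base supermodular_majorants_chain_bound[OF _ Q(1) C(1) Q(2)] by (cases "Q = {}") auto
  qed
  then obtain \<kappa> where \<kappa>: "\<kappa> \<in> ?S" and max: "\<And>\<kappa>'. \<kappa>' \<in> ?S \<Longrightarrow> \<kappa> \<le> \<kappa>' \<Longrightarrow> \<kappa>' = \<kappa>" by auto
  \<comment> \<open>The modular equation against the members of \<open>C\<close> propagates to all
    measurable \<open>B\<close>: it makes \<open>modularize M \<kappa> A\<close> a majorant above
    \<open>\<kappa>\<close>, which maximality identifies with \<open>\<kappa>\<close>.\<close>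
  have modular: "\<kappa> (A \<inter> B) + \<kappa> (A \<union> B) = \<kappa> A + \<kappa> B"
    if A: "A \<in> sets M" and B: "B \<in> sets M"
      and eq: "\<And>D. D \<in> C \<Longrightarrow> \<kappa> (A \<inter> D) + \<kappa> (A \<union> D) = \<kappa> A + \<kappa> D" for A B
  proof -
    have "modularize M \<kappa> A = \<kappa>"
      using modularize_majorant[OF \<kappa> C(1) A eq] by (intro max le_funI)
    from fun_cong[OF this, of B] B show ?thesis by (simp add: modularize_def)
  qed
  \<comment> \<open>Two members of \<open>C\<close> are comparable, so the required equation between
    them is trivial.\<close>
  have chain: "\<kappa> (A \<inter> B) + \<kappa> (A \<union> B) = \<kappa> A + \<kappa> B" if "A \<in> C" "B \<in> sets M" for A B
  proof (rule modular)
    show "A \<in> sets M" "B \<in> sets M" using that C by auto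
    fix D assume "D \<in> C"
    then have "A \<subseteq> D \<or> D \<subseteq> A" using that C(2) by (auto simp: chain_subset_def)
    then show "\<kappa> (A \<inter> D) + \<kappa> (A \<union> D) = \<kappa> A + \<kappa> D"
      by (auto simp: Int_absorb1 Int_absorb2 Un_absorb1 Un_absorb2)
  qed
  \<comment> \<open>For arbitrary \<open>A\<close> the required equation against \<open>C\<close> is
    \<open>chain\<close> with the two sets exchanged.\<close>
  have "\<kappa> (A \<inter> B) + \<kappa> (A \<union> B) = \<kappa> A + \<kappa> B" if "A \<in> sets M" "B \<in> sets M" for A B
    using that
  proof (rule modular)
    fix D assume "D \<in> C"
    from chain[OF this that(1)] show "\<kappa> (A \<inter> D) + \<kappa> (A \<union> D) = \<kappa> A + \<kappa> D"
      by (simp only: Int_commute[of A] Un_commute[of A] add.commute[of "\<kappa> A"])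
  qed
  then show ?thesis using \<kappa> by (intro that[of \<kappa>]) (auto simp: supermodular_majorants_def)
qed

lemma core_element_on_chain:
  assumes cont: "continuous_capacity M \<nu>" and sup: "supermodular M \<nu>"
    and C: "C \<subseteq> sets M" "chain_subset C"
  obtains \<mu> where "\<mu> \<in> core M \<nu>" "\<And>A. A \<in> C \<Longrightarrow> measure \<mu> A = \<nu> A"
proof -
  have cap: "capacity M \<nu>" using cont by (simp add: continuous_capacity_def)
  obtain \<kappa> where \<kappa>: "capacity M \<kappa>" "\<And>A. A \<in> sets M \<Longrightarrow> \<nu> A \<le> \<kappa> A" "\<And>A. A \<in> C \<Longrightarrow> \<kappa> A = \<nu> A"
    and add: "\<And>A B. A \<in> sets M \<Longrightarrow> B \<in> sets M \<Longrightarrow> \<kappa> (A \<inter> B) + \<kappa> (A \<union> B) = \<kappa> A + \<kappa> B"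
    using additive_majorant_exists[OF cap sup C] by blast
  have pos: "positive (sets M) (\<lambda>A. ennreal (\<kappa> A))"
    using \<kappa>(1) by (auto simp: positive_def capacity_def)
  have ca: "countably_additive (sets M) (\<lambda>A. ennreal (\<kappa> A))"
  proof (rule sets.empty_continuous_imp_countably_additive[OF pos])
    show "additive (sets M) (\<lambda>A. ennreal (\<kappa> A))"
      unfolding additive_def
    proof (intro ballI impI)
      fix A B assume "A \<in> sets M" "B \<in> sets M" "A \<inter> B = {}"
      moreover from this have "\<kappa> (A \<union> B) = \<kappa> A + \<kappa> B"
        using add[of A B] \<kappa>(1) by (auto simp: capacity_def)
      ultimately show "ennreal (\<kappa> (A \<union> B)) = ennreal (\<kappa> A) + ennreal (\<kappa> B)"
        using capacity_bounds(1)[OF \<kappa>(1)] by (simp add: ennreal_plus)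
    qed
    show "\<forall>A\<in>sets M. ennreal (\<kappa> A) \<noteq> \<infinity>" by simp
    fix A :: "nat \<Rightarrow> 'a set" assume A: "range A \<subseteq> sets M" "decseq A" "(\<Inter>i. A i) = {}"
    \<comment> \<open>Passing to complements turns \<open>\<nu> \<le> \<kappa>\<close> into an upper
      bound: additivity gives
      \<open>\<kappa> (A i) = 1 - \<kappa> (?B i) \<le> 1 - \<nu> (?B i)\<close>, which tends to 0
      by continuity of \<open>\<nu>\<close> at the whole space.\<close>
    let ?B = "\<lambda>i. space M - A i"
    have An: "A i \<in> sets M" for i using A by auto
    have "incseq ?B" using A(2) by (auto simp: incseq_def decseq_def)
    moreover have "range ?B \<subseteq> sets M" using An by auto
    moreover have "(\<Union>i. ?B i) = space M" using A(3) by auto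
    ultimately have "(\<lambda>i. \<nu> (?B i)) \<longlonglongrightarrow> \<nu> (space M)"
      using cont unfolding continuous_capacity_def by metis
    then have "(\<lambda>i. 1 - \<nu> (?B i)) \<longlonglongrightarrow> 1 - 1"
      using cap by (intro tendsto_intros) (simp add: capacity_def)
    moreover have "\<kappa> (A i) \<le> 1 - \<nu> (?B i)" for i
    proof -
      have "A i \<inter> ?B i = {}" "A i \<union> ?B i = space M"
        using sets.sets_into_space[OF An[of i]] by auto
      then show ?thesis
        using add[of "A i" "?B i"] An[of i] \<kappa>(1) \<kappa>(2)[of "?B i"] by (auto simp: capacity_def)
    qed
    ultimately have "(\<lambda>i. \<kappa> (A i)) \<longlonglongrightarrow> 0"
      using capacity_bounds(1)[OF \<kappa>(1) An]
      by (intro tendsto_sandwich[of "\<lambda>_. 0" "\<lambda>i. \<kappa> (A i)" sequentially "\<lambda>i. 1 - \<nu> (?B i)"]) auto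
    then show "(\<lambda>i. ennreal (\<kappa> (A i))) \<longlonglongrightarrow> 0"
      using tendsto_ennrealI by force
  qed
  define \<mu> where "\<mu> = measure_of (space M) (sets M) (\<lambda>A. ennreal (\<kappa> A))"
  have sets: "sets \<mu> = sets M" and space: "space \<mu> = space M"
    by (simp_all add: \<mu>_def sets.space_closed)
  have em: "emeasure \<mu> A = ennreal (\<kappa> A)" if "A \<in> sets M" for A
    using emeasure_measure_of_sigma[OF sets.sigma_algebra_axioms pos ca that] by (simp add: \<mu>_def)
  have meas: "measure \<mu> A = \<kappa> A" if "A \<in> sets M" for A
    using em[OF that] capacity_bounds(1)[OF \<kappa>(1) that] by (simp add: measure_def)
  have "prob_space \<mu>"
    using em[of "space M"] \<kappa>(1) by (intro prob_spaceI) (simp add: space capacity_def)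
  then show ?thesis using sets meas \<kappa> C by (intro that[of \<mu>]) (auto simp: core_def)
qed

section \<open>Robust aggregation\<close>

lemma Least_minimum:
  assumes "has_minimum S"
  shows "(LEAST v. v \<in> S) \<in> S"
  using assms unfolding has_minimum_def by (metis Least_equality)

text \<open>Every core value is at least the integral for \<open>\<nu>\<close>, because core
  measures dominate \<open>\<nu>\<close> and \<open>g\<close> is increasing. The bound is attained
  because the integral sees \<open>\<nu>\<close> only on the chain of upper level sets.\<close>

lemma core_values_minimum:
  assumes cont: "continuous_capacity M \<nu>" and sup: "supermodular M \<nu>" and g: "distortion g"
    and f: "u \<circ> X \<in> acts M"
  shows "choquet M (g \<circ> \<nu>) (u \<circ> X) \<in> core_values M u g \<nu> X"
    and "\<And>v. v \<in> core_values M u g \<nu> X \<Longrightarrow> choquet M (g \<circ> \<nu>) (u \<circ> X) \<le> v"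
proof -
  have cap: "capacity M \<nu>" using cont by (simp add: continuous_capacity_def)
  let ?C = "range (\<lambda>x. {\<omega> \<in> space M. (u \<circ> X) \<omega> > x})"
  have "?C \<subseteq> sets M" using level_set_sets[OF f] by auto
  moreover have "chain_subset ?C"
    unfolding chain_subset_def
  proof (intro ballI, elim imageE, hypsubst)
    fix x y :: real
    show "{\<omega> \<in> space M. (u \<circ> X) \<omega> > x} \<subseteq> {\<omega> \<in> space M. (u \<circ> X) \<omega> > y} \<or>
        {\<omega> \<in> space M. (u \<circ> X) \<omega> > y} \<subseteq> {\<omega> \<in> space M. (u \<circ> X) \<omega> > x}"
      by (cases "x \<le> y") auto
  qed
  ultimately obtain \<mu> where \<mu>: "\<mu> \<in> core M \<nu>" "\<And>A. A \<in> ?C \<Longrightarrow> measure \<mu> A = \<nu> A"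
    using core_element_on_chain[OF cont sup] by blast
  have "choquet M (g \<circ> measure \<mu>) (u \<circ> X) = choquet M (g \<circ> \<nu>) (u \<circ> X)"
    \<comment> \<open>Only the composition with \<open>g\<close> is unfolded, so the level sets keep
      the form in which \<open>?C\<close> lists them.\<close>
    using \<mu>(2) unfolding choquet_def comp_apply[of g] by (auto simp del: comp_apply)
  with \<mu>(1) show "choquet M (g \<circ> \<nu>) (u \<circ> X) \<in> core_values M u g \<nu> X"
    unfolding core_values_def by (metis imageI)
  fix v assume "v \<in> core_values M u g \<nu> X"
  then obtain \<mu>' where \<mu>': "\<mu>' \<in> core M \<nu>" "v = choquet M (g \<circ> measure \<mu>') (u \<circ> X)"
    by (auto simp: core_values_def)
  have "g (\<nu> A) \<le> g (measure \<mu>' A)" if "A \<in> sets M" for A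
    using g capacity_bounds[OF cap that] capacity_bounds[OF core_capacity[OF \<mu>'(1)] that]
      core_ge[OF \<mu>'(1) that]
    by (auto simp: distortion_def mono_on_def)
  then show "choquet M (g \<circ> \<nu>) (u \<circ> X) \<le> v"
    unfolding \<mu>'(2) using level_set_sets[OF f]
    by (intro choquet_mono capacity_distortion core_capacity[OF \<mu>'(1)] cap g f) simp
qed

lemma robust_aggregation_if_supermodular:
  assumes R: "CRDU M P u g \<nu> R" and sup: "supermodular M \<nu>"
  shows "robust_aggregation M u g \<nu> R"
proof -
  have cont: "continuous_capacity M \<nu>" and g: "distortion g"
    and u: "continuous_on UNIV u" "strict_mono u"
    using R by (auto simp: CRDU_def)
  note min = core_values_minimum[OF cont sup g comp_acts[OF u]]
  have "(LEAST v. v \<in> core_values M u g \<nu> X) = choquet M (g \<circ> \<nu>) (u \<circ> X)" if "X \<in> acts M" for X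
    using min[OF that] by (intro Least_equality) auto
  moreover have "has_minimum (core_values M u g \<nu> X)" if "X \<in> acts M" for X
    using min[OF that] by (auto simp: has_minimum_def)
  ultimately show ?thesis
    using R by (auto simp: CRDU_def robust_aggregation_def)
qed

text \<open>Two representations of one preference need agree only up to a monotone transformation.
  Here constant acts calibrate them: \<open>X\<close> is indifferent to a constant \<open>c\<close>,
  to which both functionals assign \<open>u c\<close>.\<close>

lemma robust_aggregation_value:
  assumes R: "CRDU M P u g \<nu> R" and rob: "robust_aggregation M u g \<nu> R" and X: "X \<in> acts M"
  shows "(LEAST v. v \<in> core_values M u g \<nu> X) = choquet M (g \<circ> \<nu>) (u \<circ> X)"
proof -
  have cap: "capacity M \<nu>" and g: "distortion g"
    and u: "continuous_on UNIV u" "strict_mono u"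
    using R by (auto simp: CRDU_def continuous_capacity_def)
  note capg = capacity_distortion[OF cap g]
  obtain c where c: "choquet M (g \<circ> \<nu>) (u \<circ> X) = u c"
    by (rule certainty_equivalent[OF capg u X])
  let ?c = "(\<lambda>_. c) :: 'a \<Rightarrow> real"
  have uc: "u \<circ> ?c = (\<lambda>_. u c)" by auto
  have "choquet M (g \<circ> \<nu>) (u \<circ> ?c) = u c" unfolding uc by (rule choquet_const[OF capg])
  then have "(X, ?c) \<in> R" "(?c, X) \<in> R" using R X c by (auto simp: CRDU_def)
  then have "(LEAST v. v \<in> core_values M u g \<nu> X) = (LEAST v. v \<in> core_values M u g \<nu> ?c)"
    using rob X by (intro antisym) (auto simp: robust_aggregation_def)
  moreover have "(LEAST v. v \<in> core_values M u g \<nu> ?c) \<in> core_values M u g \<nu> ?c"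
    using rob by (intro Least_minimum) (simp add: robust_aggregation_def)
  \<comment> \<open>Every core measure integrates the constant act to \<open>u c\<close>; the
    inclusion suffices because the least value was shown to be a member.\<close>
  moreover have "core_values M u g \<nu> ?c \<subseteq> {u c}"
    unfolding core_values_def uc
    using choquet_const[OF capacity_distortion[OF core_capacity g]] by auto
  ultimately show ?thesis using c by auto
qed

lemma supermodular_if_robust_aggregation:
  assumes R: "CRDU M P u g \<nu> R" and rob: "robust_aggregation M u g \<nu> R"
  shows "supermodular M \<nu>"
  unfolding supermodular_def
proof (intro ballI)
  fix A B assume A: "A \<in> sets M" and B: "B \<in> sets M"
  have cap: "capacity M \<nu>" and g: "distortion g" and gs: "strict_mono_on {0..1} g"
    and u: "continuous_on UNIV u" "strict_mono u"
    using R by (auto simp: CRDU_def continuous_capacity_def)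
  let ?D = "A \<inter> B" and ?E = "A \<union> B"
  have DE: "?D \<in> sets M" "?E \<in> sets M" "?D \<subseteq> ?E" using A B by auto
  \<comment> \<open>This is the sum of the indicators of \<open>A\<close> and \<open>B\<close> on
    the space. Its three values stay strictly ordered under \<open>u\<close>, so
    \<open>g (\<nu> ?E)\<close> and \<open>g (\<nu> ?D)\<close> enter the integral with positive
    weights.\<close>
  define X :: "'a \<Rightarrow> real" where "X = (\<lambda>\<omega>. if \<omega> \<in> ?D then 2 else if \<omega> \<in> ?E then 1 else 0)"
  have X: "X \<in> acts M" unfolding X_def using DE(1,2) by (rule step_acts)
  have uX: "u \<circ> X = (\<lambda>\<omega>. if \<omega> \<in> ?D then u 2 else if \<omega> \<in> ?E then u 1 else u 0)"
    by (auto simp: X_def fun_eq_iff)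
  have u012: "u 0 < u 1" "u 1 < u 2" using u(2) by (auto simp: strict_mono_def)
  have val: "choquet M \<kappa> (u \<circ> X) = u 0 + (u 1 - u 0) * \<kappa> ?E + (u 2 - u 1) * \<kappa> ?D"
    if "capacity M \<kappa>" for \<kappa>
    unfolding uX using u012 by (intro choquet_step that DE) auto
  have "choquet M (g \<circ> \<nu>) (u \<circ> X) \<in> core_values M u g \<nu> X"
    unfolding robust_aggregation_value[OF R rob X, symmetric]
    using rob X by (intro Least_minimum) (simp add: robust_aggregation_def)
  then obtain \<mu> where \<mu>: "\<mu> \<in> core M \<nu>"
    and eq: "choquet M (g \<circ> \<nu>) (u \<circ> X) = choquet M (g \<circ> measure \<mu>) (u \<circ> X)"
    by (auto simp: core_values_def)
  have cap\<mu>: "capacity M (measure \<mu>)" by (rule core_capacity[OF \<mu>])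
  have in01: "\<nu> S \<in> {0..1}" "measure \<mu> S \<in> {0..1}" if "S \<in> sets M" for S
    using capacity_bounds[OF cap that] capacity_bounds[OF cap\<mu> that] by auto
  have le: "g (\<nu> S) \<le> g (measure \<mu> S)" if "S \<in> sets M" for S
    using g in01[OF that] core_ge[OF \<mu> that] by (auto simp: distortion_def mono_on_def)
  have "(u 1 - u 0) * g (\<nu> ?E) + (u 2 - u 1) * g (\<nu> ?D) =
      (u 1 - u 0) * g (measure \<mu> ?E) + (u 2 - u 1) * g (measure \<mu> ?D)"
    using eq by (simp add: val capacity_distortion cap cap\<mu> g)
  moreover have "(u 1 - u 0) * g (\<nu> ?E) \<le> (u 1 - u 0) * g (measure \<mu> ?E)"
    "(u 2 - u 1) * g (\<nu> ?D) \<le> (u 2 - u 1) * g (measure \<mu> ?D)"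
    using u012 le DE by (auto intro!: mult_left_mono)
  \<comment> \<open>Two termwise inequalities with equal sums are equalities.\<close>
  ultimately have "(u 1 - u 0) * g (\<nu> ?E) = (u 1 - u 0) * g (measure \<mu> ?E)"
    "(u 2 - u 1) * g (\<nu> ?D) = (u 2 - u 1) * g (measure \<mu> ?D)" by linarith+
  then have "g (\<nu> ?E) = g (measure \<mu> ?E)" "g (\<nu> ?D) = g (measure \<mu> ?D)" using u012 by auto
  then have "\<nu> ?E = measure \<mu> ?E" "\<nu> ?D = measure \<mu> ?D"
    using inj_onD[OF strict_mono_on_imp_inj_on[OF gs]] in01 DE by metis+
  moreover have "measure \<mu> A + measure \<mu> B = measure \<mu> ?E + measure \<mu> ?D"
  proof -
    interpret prob_space \<mu> using \<mu> by (simp add: core_def)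
    have "sets \<mu> = sets M" using \<mu> by (simp add: core_def)
    then show ?thesis
      using A B finite_measure_Union'[of A B] finite_measure_Diff'[of B A]
      by (simp add: Int_commute)
  qed
  \<comment> \<open>The core inequality is used at \<open>A\<close> and \<open>B\<close>, and the
    equality of \<open>\<mu>\<close> and \<open>\<nu>\<close> at \<open>?E\<close> and
    \<open>?D\<close>.\<close>
  ultimately show "\<nu> A + \<nu> B \<le> \<nu> ?E + \<nu> ?D"
    using core_ge[OF \<mu> A] core_ge[OF \<mu> B] by simp
qed

theorem theorem5:
  fixes M P :: "'a measure"
    and u g :: "real \<Rightarrow> real"
    and \<nu> :: "'a set \<Rightarrow> real"
    and R :: "('a \<Rightarrow> real) rel"
  assumes "prob_space P" and "subalgebra M P" and "atomless P"
    and "CRDU M P u g \<nu> R"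
  shows "robust_aggregation M u g \<nu> R \<longleftrightarrow> supermodular M \<nu>"
  using robust_aggregation_if_supermodular supermodular_if_robust_aggregation assms(4) by blast

end
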